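(* Let $G^g$ be a game with activeness, $\bm{\gamma}\in\{0,1\}^{\infty}$ and $n\in\mathbb{Z}_{\ge0}$. If $G^g={\ast}^{\bm{\gamma}}n$, then $\mathcal{G}(G^g)=n$.
   Context: Let $\mathcal{B}=\{0,1\}$. Define $\mathbb{I}_0=\{\emptyset\}\times\mathcal{B}$ and $\mathbb{I}_n=2^{\mathbb{I}_{n-1}}\times\mathcal{B}$ for $n\ge1$; a game with activeness is an element of $\mathbb{I}=\bigcup_{n\ge0}\mathbb{I}_n$. A pair $(G,g)$ is written $G^g$; elements of $G$ are its options, $g=1$ meaning active. The outcome $o$ is defined recursively: $o(G^g)=\mathscr{N}$ if $g=1$ and some option has outcome $\mathscr{P}$, and $o(G^g)=\mathscr{P}$ otherwise. The sum is $G^g+H^h=(\{G'^{g'}+H^h:G'^{g'}\in G^g\}\cup\{G^g+H'^{h'}:H'^{h'}\in H^h\})^{\max\{g,h\}}$. $G^g=H^h$ means $o(G^g+X^x)=o(H^h+X^x)$ for all games $X^x$. For $\bm{\gamma}\in\mathcal{B}^\infty$, ${\ast}^{\bm{\gamma}}i=\{{\ast}^{\bm{\gamma}}j:0\le j<i\}^{\gamma_i}$ recursively. $\mathcal{G}(G^g)=\mathrm{mex}\{\mathcal{G}(G'^{g'}):G'^{g'}\in G^g\}$ recursively, with $\mathrm{mex}\,S=\min(\mathbb{Z}_{\ge0}\setminus S)$. *)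

theory Defs
  imports Main "HOL-Library.FSet"
begin

text \<open>
  Every \<open>\<I>\<^sub>n\<close> is a finite set, so the games with activeness are exactly the
  hereditarily finite sets whose nodes carry an activeness bit (\<open>True\<close> for
  1, \<open>False\<close> for 0). The lemma \<open>games_level_exhaust\<close> below relates the datatype to
  the levels \<open>\<I>\<^sub>n\<close>.
\<close>

datatype game = Game (opts: "game fset") (active: bool)

fun games_level :: "nat \<Rightarrow> game set" where
  "games_level 0 = {Game {||} g | g. True}"
| "games_level (Suc n) = {Game G g | G g. fset G \<subseteq> games_level n}"

lemma games_level_Suc: "games_level n \<subseteq> games_level (Suc n)"
proof (induction n)
  case 0
  have "Game {||} g \<in> games_level (Suc 0)" for g
    by (simp del: games_level.simps(1))
  then show ?case by (auto simp del: games_level.simps(2))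
next
  case (Suc n)
  show ?case
  proof
    fix X
    assume "X \<in> games_level (Suc n)"
    then obtain G g where X: "X = Game G g" "fset G \<subseteq> games_level n"
      unfolding games_level.simps(2) by (elim CollectE exE conjE)
    from X(2) Suc have "fset G \<subseteq> games_level (Suc n)"
      by (rule subset_trans)
    with X(1) show "X \<in> games_level (Suc (Suc n))"
      unfolding games_level.simps(2)[of "Suc n"] by (intro CollectI exI conjI)
  qed
qed

lemma games_level_mono: "m \<le> n \<Longrightarrow> games_level m \<subseteq> games_level n"
  by (rule lift_Suc_mono_le[of games_level]) (rule games_level_Suc)

lemma finite_games_level: "finite (games_level n)"
proof (induction n)
  case 0
  have "games_level 0 = range (Game {||})" by auto
  then show ?case by simp
next
  case (Suc n)
  have "games_level (Suc n)
      \<subseteq> (\<lambda>(A, g). Game (Abs_fset A) g) ` (Pow (games_level n) \<times> UNIV)"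
  proof
    fix X
    assume "X \<in> games_level (Suc n)"
    then obtain G g where "X = Game G g" "fset G \<subseteq> games_level n" by auto
    then show "X \<in> (\<lambda>(A, g). Game (Abs_fset A) g) ` (Pow (games_level n) \<times> UNIV)"
      by (intro image_eqI[of _ _ "(fset G, g)"]) (simp_all add: fset_inverse)
  qed
  moreover have "finite (Pow (games_level n) \<times> (UNIV :: bool set))"
    using Suc by simp
  ultimately show ?case
    by (rule finite_subset[OF _ finite_imageI])
qed

lemma games_level_exhaust: "(\<Union>n. games_level n) = UNIV"
proof -
  have "\<exists>n. X \<in> games_level n" for X
  proof (induction X)
    case (Game G g)
    then obtain f where f: "\<And>X. X \<in> fset G \<Longrightarrow> X \<in> games_level (f X)"
      by metis
    define N where "N = (\<Sum>X\<in>fset G. f X)"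
    have "f X \<le> N" if "X \<in> fset G" for X
      unfolding N_def by (rule member_le_sum) (use that in auto)
    then have "fset G \<subseteq> games_level N"
      using f games_level_mono by blast
    then show ?case by (intro exI[of _ "Suc N"]) simp
  qed
  then show ?thesis by blast
qed

datatype outcome_class = Out_N | Out_P

primrec outcome :: "game \<Rightarrow> outcome_class" where
  "outcome (Game G g) = (if g \<and> Out_P |\<in>| outcome |`| G then Out_N else Out_P)"

lemma size_option_less: "X |\<in>| G \<Longrightarrow> size X < size (Game G g)"
proof -
  assume "X |\<in>| G"
  then have "Suc (size X) \<le> (\<Sum>Y\<in>fset G. Suc (size Y))"
    by (intro member_le_sum[where f = "\<lambda>Y. Suc (size Y)"]) auto
  then show ?thesis by simp
qed

declare fset.map_cong [fundef_cong]

function game_sum :: "game \<Rightarrow> game \<Rightarrow> game" (infixl "\<oplus>" 65) where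
  "Game G g \<oplus> Game H h =
     Game ((\<lambda>G'. G' \<oplus> Game H h) |`| G |\<union>| (\<lambda>H'. Game G g \<oplus> H') |`| H) (g \<or> h)"
  by pat_completeness auto
termination
  by (relation "measure (\<lambda>(X, Y). size X + size Y)")
    (auto simp del: game.size simp: size_option_less)

definition game_eq :: "game \<Rightarrow> game \<Rightarrow> bool" (infix "\<doteq>" 50) where
  "G \<doteq> H \<longleftrightarrow> (\<forall>X. outcome (G \<oplus> X) = outcome (H \<oplus> X))"

function star :: "(nat \<Rightarrow> bool) \<Rightarrow> nat \<Rightarrow> game" where
  "star \<gamma> i = Game (star \<gamma> |`| fset_of_list [0..<i]) (\<gamma> i)"
  by pat_completeness auto
termination
  by (relation "measure snd") (auto simp: fset_of_list_elem)

declare star.simps [simp del]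

definition mex :: "nat set \<Rightarrow> nat" where
  "mex S = (LEAST n. n \<notin> S)"

primrec grundy :: "game \<Rightarrow> nat" where
  "grundy (Game G g) = mex (fset (grundy |`| G))"

end

theory Submission
  imports Defs
begin

text \<open>
  Adding a nim heap all of whose positions are active makes every position of the sum
  active, so the sum is played as under ordinary normal play: \<open>G \<oplus> \<ast>n\<close> is a
  \<open>\<P>\<close>-position exactly when \<open>G\<close> has Grundy value \<open>n\<close>, whatever
  the activeness inside \<open>G\<close>. Thus equality of games preserves Grundy values, and
  the Grundy value of \<open>star \<gamma> n\<close> is \<open>n\<close>.
\<close>

lemma mex_notin: "finite S \<Longrightarrow> mex S \<notin> S"
  unfolding mex_def by (rule LeastI_ex) (rule ex_new_if_finite[OF infinite_UNIV_nat])

lemma less_mex_in: "k < mex S \<Longrightarrow> k \<in> S"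
  unfolding mex_def using not_less_Least by blast

lemma mex_lessThan: "mex {..<n} = n"
  unfolding mex_def by (rule Least_equality) auto

lemma grundy_star: "grundy (star \<gamma> n) = n"
proof (induction n rule: less_induct)
  case (less n)
  then have "(\<lambda>i. grundy (star \<gamma> i)) ` {0..<n} = {..<n}"
    by force
  then show ?case
    by (subst star.simps) (simp add: fset_of_list.rep_eq image_image mex_lessThan)
qed

text \<open>Induction on \<open>size G + n\<close>: a winning move either reaches an option of
  \<open>G\<close> with Grundy value \<open>n\<close> or lowers the heap to
  \<open>grundy G\<close>.\<close>

lemma outcome_sum_active_star:
  "outcome (G \<oplus> star (\<lambda>_. True) n) = Out_P \<longleftrightarrow> grundy G = n"
proof (induction "size G + n" arbitrary: G n rule: less_induct)
  case less
  obtain A a where G: "G = Game A a" by (cases G)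
  define S where "S = fset (grundy |`| A)"
  have mex: "grundy G = mex S" by (simp add: G S_def)
  have left: "outcome (G' \<oplus> star (\<lambda>_. True) n) = Out_P \<longleftrightarrow> grundy G' = n"
    if "G' |\<in>| A" for G'
    using less size_option_less[OF that, of a] by (simp add: G del: game.size)
  have right: "outcome (G \<oplus> star (\<lambda>_. True) j) = Out_P \<longleftrightarrow> grundy G = j" if "j < n" for j
    using less that by simp
  \<comment> \<open>Unfolded once so that the equation of \<open>\<oplus>\<close> applies; the bit
    \<open>True\<close> makes the sum active whatever \<open>a\<close> is.\<close>
  let ?heap = "Game (star (\<lambda>_. True) |`| fset_of_list [0..<n]) True"
  have heap: "star (\<lambda>_. True) n = ?heap" by (rule star.simps)
  have "outcome (G \<oplus> ?heap) = Out_N \<longleftrightarrow>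
      (\<exists>G'. G' |\<in>| A \<and> outcome (G' \<oplus> ?heap) = Out_P) \<or>
      (\<exists>j<n. outcome (G \<oplus> star (\<lambda>_. True) j) = Out_P)"
    by (auto simp: G image_iff fset_of_list.rep_eq eq_commute[of Out_P] ball_Un)
  then have "outcome (G \<oplus> star (\<lambda>_. True) n) = Out_N \<longleftrightarrow> n \<in> S \<or> grundy G < n"
    using left right unfolding heap[symmetric] S_def by auto
  \<comment> \<open>\<open>mex S\<close> itself lies outside \<open>S\<close>, and everything below
    it lies in \<open>S\<close>.\<close>
  moreover have "n \<in> S \<or> mex S < n \<longleftrightarrow> mex S \<noteq> n"
    using mex_notin[of S] less_mex_in[of n S] by (auto simp: S_def)
  ultimately show ?case
    unfolding mex by (metis outcome_class.exhaust outcome_class.distinct(1))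
qed

theorem theorem3p49:
  fixes G :: game and \<gamma> :: "nat \<Rightarrow> bool" and n :: nat
  assumes "G \<doteq> star \<gamma> n"
  shows "grundy G = n"
  \<comment> \<open>Test both games against the all-active heap of size \<open>n\<close>: its sum
    with \<open>star \<gamma> n\<close> has outcome \<open>Out_P\<close>, hence so does its sum with
    \<open>G\<close>.\<close>
  using assms unfolding game_eq_def by (metis outcome_sum_active_star grundy_star)

end
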